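(* Let $\kappa$ be a cardinal and let $\langle X_\alpha:\alpha<\kappa\rangle$ be $T_1$ topological spaces. Then $$\operatorname{sm}\Big(\sum_{\alpha<\kappa}X_\alpha\Big)\le\sup_{\alpha<\kappa}|X_\alpha|,$$ where $\sum_{\alpha<\kappa}X_\alpha$ is the topological sum (disjoint union).
   Context: Set membership game $G_\beta(Y,X)$ ($X$ a topological space, $Y\subseteq X$, $\beta$ an ordinal): two players, Seeker and Hider, make $\beta$ moves. At move $\alpha<\beta$, knowing all previous moves, the Seeker chooses an open set $U_\alpha\subseteq X$, and then the Hider chooses $V_\alpha\in\{U_\alpha, X\setminus U_\alpha\}$. The outcome is $W=\bigcap_{\alpha<\beta}V_\alpha$ (with $W=X$ if $\beta=0$). The Seeker wins iff $W\subseteq Y$ or $W\cap Y=\emptyset$. For a $T_0$ space $X$: $\operatorname{sm}(Y,X)$ is the least ordinal $\beta$ such that the Seeker has a winning strategy in $G_\beta(Y,X)$, and $\operatorname{sm}(X)=\sup\{\operatorname{sm}(Y,X):Y\subseteq X\}$ (an ordinal). Cardinals are identified with initial ordinals, so the inequality is between ordinals. *)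

theory Defs
  imports "HOL-Analysis.Analysis"
begin

unbundle cardinal_syntax
no_notation elt_set_eq (infix \<open>=o\<close> 50)

section \<open>Ordinals as well-orders\<close>

text \<open>
  An ordinal is represented by a (reflexive) well-order, determined up to the isomorphism \<open>=o\<close> and
  compared, also across types, by \<open>\<le>o\<close>; its elements are the members of \<open>Field r\<close>, and the
  predecessors of \<open>a\<close> are \<open>underS r a\<close>. The initial ordinal of the cardinality of a set \<open>A\<close> is \<open>|A|\<close>.

  The least ordinal with property \<open>P\<close> is sought among the well-orders on one type. This is no
  restriction once some well-order on that type satisfies \<open>P\<close>, since every smaller ordinal is then
  represented on the same type: see \<open>ord_Least_le\<close>.
\<close>

definition ord_Least :: "('b rel \<Rightarrow> bool) \<Rightarrow> 'b rel" where
  "ord_Least P = (SOME r. Well_order r \<and> P r \<and> (\<forall>s. Well_order s \<and> P s \<longrightarrow> r \<le>o s))"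

definition ord_Sup :: "'b rel set \<Rightarrow> 'b rel" where
  "ord_Sup R = ord_Least (\<lambda>r. \<forall>s\<in>R. s \<le>o r)"

lemma ord_Least_works:
  assumes "Well_order r" "P r"
  shows "Well_order (ord_Least P) \<and> P (ord_Least P) \<and>
         (\<forall>s. Well_order s \<and> P s \<longrightarrow> ord_Least P \<le>o s)"
proof -
  have "r \<in> {r. Well_order r \<and> P r}" using assms by simp
  then obtain m where m: "Well_order m" "P m"
      "\<And>s. s <o m \<Longrightarrow> s \<notin> {r. Well_order r \<and> P r}"
    using wfE_min[OF wf_ordLess] by (metis (no_types, lifting) mem_Collect_eq)
  have "\<forall>s. Well_order s \<and> P s \<longrightarrow> m \<le>o s"
    using m not_ordLess_iff_ordLeq by blast
  with m show ?thesis
    unfolding ord_Least_def by (intro someI) auto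
qed

lemma ord_Least_le:
  fixes P :: "'b rel \<Rightarrow> bool" and s :: "'c rel"
  assumes r: "Well_order r" "P r" and s: "Well_order s"
    and P: "\<And>s'. Well_order s' \<Longrightarrow> s' =o s \<Longrightarrow> P s'"
  shows "ord_Least P \<le>o s"
proof (rule ccontr)
  note least = ord_Least_works[of r P, OF r]
  assume "\<not> ord_Least P \<le>o s"
  then have "s <o ord_Least P"
    using least s not_ordLeq_iff_ordLess by blast
  then obtain a where a: "a \<in> Field (ord_Least P)"
      "s =o Restr (ord_Least P) (underS (ord_Least P) a)" (is "_ =o ?t")
    using least s ordLess_iff_ordIso_Restr by blast
  have t: "?t =o s" using a(2) by (rule ordIso_symmetric)
  then have "Well_order ?t" unfolding ordIso_def by blast
  then have "ord_Least P \<le>o ?t" using P[OF _ t] least by blast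
  then have "ord_Least P \<le>o s" using t by (rule ordLeq_ordIso_trans)
  then show False using \<open>\<not> ord_Least P \<le>o s\<close> by contradiction
qed

section \<open>The set membership game\<close>

text \<open>
  The moves are indexed by \<open>Field r\<close>. A play \<open>p\<close> assigns to each index \<open>a\<close> the pair
  \<open>(U\<^sub>a, V\<^sub>a)\<close> of moves of Seeker and Hider. A strategy of the Seeker receives the index of the
  current move and the play so far, that is \<open>p\<close> restricted to the indices preceding it.
\<close>

type_synonym ('b, 'a) play = "'b \<Rightarrow> 'a set \<times> 'a set"
type_synonym ('b, 'a) strategy = "'b \<Rightarrow> ('b, 'a) play \<Rightarrow> 'a set"

definition is_play :: "'b rel \<Rightarrow> 'a topology \<Rightarrow> ('b, 'a) play \<Rightarrow> bool" where
  "is_play r X p \<longleftrightarrow> (\<forall>a\<in>Field r. openin X (fst (p a)) \<and>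
      snd (p a) \<in> {fst (p a), topspace X - fst (p a)})"

definition outcome :: "'b rel \<Rightarrow> 'a topology \<Rightarrow> ('b, 'a) play \<Rightarrow> 'a set" where
  "outcome r X p = topspace X \<inter> (\<Inter>a\<in>Field r. snd (p a))"

definition is_strategy :: "'b rel \<Rightarrow> 'a topology \<Rightarrow> ('b, 'a) strategy \<Rightarrow> bool" where
  "is_strategy r X \<sigma> \<longleftrightarrow> (\<forall>a\<in>Field r. \<forall>h. openin X (\<sigma> a h))"

definition follows :: "'b rel \<Rightarrow> ('b, 'a) strategy \<Rightarrow> ('b, 'a) play \<Rightarrow> bool" where
  "follows r \<sigma> p \<longleftrightarrow> (\<forall>a\<in>Field r. fst (p a) = \<sigma> a (restrict p (underS r a)))"

definition seeker_wins :: "'b rel \<Rightarrow> 'a set \<Rightarrow> 'a topology \<Rightarrow> bool" where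
  "seeker_wins r Y X \<longleftrightarrow> (\<exists>\<sigma>. is_strategy r X \<sigma> \<and>
      (\<forall>p. is_play r X p \<and> follows r \<sigma> p \<longrightarrow>
           outcome r X p \<subseteq> Y \<or> outcome r X p \<inter> Y = {}))"

text \<open>
  For a \<open>T\<^sub>0\<close> space, playing all open sets in turn wins for the Seeker, so well-orders on the type
  of sets of points suffice for both of the following; see \<open>sm_set_works\<close> and \<open>sm_works\<close>.
\<close>

definition sm_set :: "'a set \<Rightarrow> 'a topology \<Rightarrow> 'a set rel" where
  "sm_set Y X = ord_Least (\<lambda>r. seeker_wins r Y X)"

definition sm :: "'a topology \<Rightarrow> 'a set rel" where
  "sm X = ord_Sup ((\<lambda>Y. sm_set Y X) ` Pow (topspace X))"

lemma seeker_wins_ordIso: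
  fixes s :: "'c rel" and r :: "'b rel"
  assumes "s =o r" and win: "seeker_wins s Y X"
  shows "seeker_wins r Y X"
proof -
  obtain f where wo: "Well_order s" "Well_order r" and f: "iso s r f"
    using assms unfolding ordIso_def by blast
  then have bij: "bij_betw f (Field s) (Field r)" and emb: "embed s r f"
    by (auto simp: iso_def)
  define g where "g = inv_into (Field s) f"
  have gf: "g (f a) = a" if "a \<in> Field s" for a
    using bij that by (simp add: g_def bij_betw_def)
  have gF: "g b \<in> Field s" if "b \<in> Field r" for b
    using bij that by (metis bij_betw_imp_surj_on g_def inv_into_into)
  have fF: "f a \<in> Field r" if "a \<in> Field s" for a
    using bij that bij_betwE by blast
  have fU: "f x \<in> underS r (f a)" if "x \<in> underS s a" "a \<in> Field s" for x a
    using embed_underS[OF wo(1) emb that(2)] that(1) bij_betwE by blast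
  from win obtain \<sigma> where \<sigma>: "is_strategy s X \<sigma>"
    and w: "\<And>p. is_play s X p \<Longrightarrow> follows s \<sigma> p \<Longrightarrow>
              outcome s X p \<subseteq> Y \<or> outcome s X p \<inter> Y = {}"
    unfolding seeker_wins_def by blast
  define \<tau> where "\<tau> b h = \<sigma> (g b) (restrict (h \<circ> f) (underS s (g b)))" for b h
  have "outcome r X p \<subseteq> Y \<or> outcome r X p \<inter> Y = {}"
    if p: "is_play r X p" "follows r \<tau> p" for p
  proof -
    have "is_play s X (p \<circ> f)"
      using p(1) fF unfolding is_play_def by simp
    moreover have "follows s \<sigma> (p \<circ> f)"
      unfolding follows_def
    proof
      fix a assume a: "a \<in> Field s"
      have "restrict (restrict p (underS r (f a)) \<circ> f) (underS s a) =
            restrict (p \<circ> f) (underS s a)"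
        using fU[OF _ a] by (auto simp: restrict_def fun_eq_iff)
      then show "fst ((p \<circ> f) a) = \<sigma> a (restrict (p \<circ> f) (underS s a))"
        using p(2) fF[OF a] gf[OF a] unfolding follows_def \<tau>_def by simp
    qed
    moreover have "outcome s X (p \<circ> f) = outcome r X p"
      unfolding outcome_def bij_betw_imp_surj_on[OF bij, symmetric] by simp
    ultimately show ?thesis using w by metis
  qed
  moreover have "is_strategy r X \<tau>"
    using \<sigma> gF unfolding is_strategy_def \<tau>_def by blast
  ultimately show ?thesis unfolding seeker_wins_def by blast
qed

lemma seeker_wins_t0_space:
  assumes "t0_space X"
  shows "seeker_wins |{U. openin X U}| Y X"
proof -
  let ?r = "|{U. openin X U}|"
  define \<sigma> :: "('a set, 'a) strategy" where "\<sigma> U h = U" for U h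
  have "outcome ?r X p \<subseteq> Y \<or> outcome ?r X p \<inter> Y = {}"
    if p: "is_play ?r X p" "follows ?r \<sigma> p" for p
  proof -
    have V: "snd (p U) = U \<or> snd (p U) = topspace X - U" if "openin X U" for U
      using p that unfolding is_play_def follows_def \<sigma>_def by (auto simp: Field_card_of)
    have "x = y" if "x \<in> outcome ?r X p" "y \<in> outcome ?r X p" for x y
    proof (rule ccontr)
      assume "x \<noteq> y"
      moreover have "x \<in> topspace X" "y \<in> topspace X"
        using that by (simp_all add: outcome_def)
      ultimately obtain U where U: "openin X U" "x \<notin> U \<longleftrightarrow> y \<in> U"
        using assms unfolding t0_space_def by metis
      then have "x \<in> snd (p U)" "y \<in> snd (p U)"
        using that by (simp_all add: outcome_def Field_card_of)
      then show False using U(2) V[OF U(1)] by auto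
    qed
    then show ?thesis by blast
  qed
  moreover have "is_strategy ?r X \<sigma>"
    by (simp add: is_strategy_def \<sigma>_def Field_card_of)
  ultimately show ?thesis unfolding seeker_wins_def by blast
qed

lemma sm_set_works:
  fixes X :: "'a topology" and s :: "'c rel"
  assumes "t0_space X"
  shows "Well_order (sm_set Y X)" "seeker_wins (sm_set Y X) Y X"
    and "Well_order s \<Longrightarrow> seeker_wins s Y X \<Longrightarrow> sm_set Y X \<le>o s"
proof -
  note wo = card_of_Well_order[of "{U. openin X U}"]
  note win = seeker_wins_t0_space[OF assms, of Y]
  note works = ord_Least_works[of _ "\<lambda>r. seeker_wins r Y X", OF wo win, folded sm_set_def]
  show "Well_order (sm_set Y X)" "seeker_wins (sm_set Y X) Y X"
    using works by auto
  show "sm_set Y X \<le>o s" if s: "Well_order s" "seeker_wins s Y X"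
    unfolding sm_set_def
  proof (rule ord_Least_le[of _ "\<lambda>r. seeker_wins r Y X", OF wo win s(1)])
    fix s' assume "s' =o s"
    then show "seeker_wins s' Y X"
      by (rule seeker_wins_ordIso[OF ordIso_symmetric s(2)])
  qed
qed

lemma sm_works:
  fixes X :: "'a topology" and s :: "'c rel"
  assumes X: "t0_space X"
  shows "Well_order (sm X)" "Y \<subseteq> topspace X \<Longrightarrow> sm_set Y X \<le>o sm X"
    and "Well_order s \<Longrightarrow> (\<And>Y. Y \<subseteq> topspace X \<Longrightarrow> sm_set Y X \<le>o s) \<Longrightarrow> sm X \<le>o s"
proof -
  let ?R = "(\<lambda>Y. sm_set Y X) ` Pow (topspace X)"
  have wo: "Well_order |{U. openin X U}|" by (rule card_of_Well_order)
  have ub: "\<forall>t\<in>?R. t \<le>o |{U. openin X U}|"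
    using sm_set_works(3)[OF X wo] seeker_wins_t0_space[OF X] by blast
  note works = ord_Least_works[of _ "\<lambda>r. \<forall>t\<in>?R. t \<le>o r", OF wo ub, folded ord_Sup_def sm_def]
  show "Well_order (sm X)" "Y \<subseteq> topspace X \<Longrightarrow> sm_set Y X \<le>o sm X"
    using works by auto
  show "sm X \<le>o s" if "Well_order s" "\<And>Y. Y \<subseteq> topspace X \<Longrightarrow> sm_set Y X \<le>o s"
    unfolding sm_def ord_Sup_def
  proof (rule ord_Least_le[of _ "\<lambda>r. \<forall>t\<in>?R. t \<le>o r", OF wo ub that(1)])
    fix s' assume "s' =o s"
    then have "s =o s'" by (rule ordIso_symmetric)
    then show "\<forall>t\<in>?R. t \<le>o s'"
      by (auto intro: ordLeq_ordIso_trans[OF that(2)])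
  qed
qed

text \<open>
  The supremum of the initial ordinals \<open>|A|\<close> for sets \<open>A\<close> over one type exists on that type,
  being bounded by \<open>|UNIV|\<close>.
\<close>

lemma ord_Sup_card_of_works:
  fixes A :: "'i \<Rightarrow> 'a set" and s :: "'c rel"
  shows "Well_order (ord_Sup ((\<lambda>i. |A i| ) ` I))"
    and "i \<in> I \<Longrightarrow> |A i| \<le>o ord_Sup ((\<lambda>i. |A i| ) ` I)"
    and "Well_order s \<Longrightarrow> (\<And>i. i \<in> I \<Longrightarrow> |A i| \<le>o s) \<Longrightarrow> ord_Sup ((\<lambda>i. |A i| ) ` I) \<le>o s"
proof -
  let ?R = "(\<lambda>i. |A i| ) ` I"
  have wo: "Well_order |UNIV :: 'a set|" by (rule card_of_Well_order)
  have ub: "\<forall>t\<in>?R. t \<le>o |UNIV :: 'a set|" using card_of_mono1[OF subset_UNIV] by blast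
  note works = ord_Least_works[of _ "\<lambda>r. \<forall>t\<in>?R. t \<le>o r", OF wo ub, folded ord_Sup_def]
  show "Well_order (ord_Sup ?R)" "i \<in> I \<Longrightarrow> |A i| \<le>o ord_Sup ?R"
    using works by auto
  show "ord_Sup ?R \<le>o s" if "Well_order s" "\<And>i. i \<in> I \<Longrightarrow> |A i| \<le>o s"
    unfolding ord_Sup_def
  proof (rule ord_Least_le[of _ "\<lambda>r. \<forall>t\<in>?R. t \<le>o r", OF wo ub that(1)])
    fix s' assume "s' =o s"
    then have "s =o s'" by (rule ordIso_symmetric)
    then show "\<forall>t\<in>?R. t \<le>o s'"
      by (auto intro: ordLeq_ordIso_trans[OF that(2)])
  qed
qed

end

theory Submission
  imports Defs
begin

text \<open>
  A Seeker who plays a fixed family of open sets, whatever the Hider does, wins as soon as some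
  member of the family separates each point of \<open>Y\<close> from each point outside \<open>Y\<close>. Let \<open>\<mu>\<close> be the
  supremum of the cardinalities and number the points of each summand injectively by \<open>\<xi> < \<mu>\<close>. If
  \<open>\<mu>\<close> is infinite, the Seeker plays, for each \<open>\<xi>\<close>, two sets: the points not numbered \<open>\<xi>\<close>, which are
  open as the summands are \<open>T\<^sub>1\<close>, and the union of the summands in which the point numbered \<open>\<xi>\<close>
  lies in \<open>Y\<close>. If \<open>\<mu>\<close> is finite, the sum is discrete and the single move \<open>Y\<close> suffices.
\<close>

lemma seeker_wins_separating_family:
  assumes op: "\<And>U. U \<in> \<U> \<Longrightarrow> openin X U"
    and card: "|\<U>| \<le>o |S|"
    and sep: "\<And>x y. x \<in> topspace X \<inter> Y \<Longrightarrow> y \<in> topspace X - Y \<Longrightarrow>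
                 \<exists>U\<in>\<U>. \<not> (x \<in> U \<longleftrightarrow> y \<in> U)"
  shows "seeker_wins |S| Y X"
proof -
  obtain f where f: "inj_on f \<U>" "f ` \<U> \<subseteq> S"
    using card by (auto simp: card_of_ordLeq[symmetric])
  \<comment> \<open>The family may have fewer members than there are moves. Indices outside the
    image of \<open>f\<close> get the filler move \<open>{}\<close>, which is open; at every index
    the history \<open>h\<close> is ignored.\<close>
  define \<sigma> :: "('b, 'a) strategy" where
    "\<sigma> a h = (if a \<in> f ` \<U> then inv_into \<U> f a else {})" for a h
  have "outcome |S| X p \<subseteq> Y \<or> outcome |S| X p \<inter> Y = {}"
    if p: "is_play |S| X p" "follows |S| \<sigma> p" for p
  proof (rule ccontr)
    assume "\<not> ?thesis"
    then obtain x y where xy: "x \<in> outcome |S| X p" "x \<in> Y" "y \<in> outcome |S| X p" "y \<notin> Y"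
      by blast
    then have top: "x \<in> topspace X" "y \<in> topspace X"
      by (simp_all add: outcome_def)
    then obtain U where U: "U \<in> \<U>" "\<not> (x \<in> U \<longleftrightarrow> y \<in> U)"
      using sep[of x y] xy by blast
    have fU: "f U \<in> Field |S|"
      using f(2) U(1) by (auto simp: Field_card_of)
    \<comment> \<open>Move \<open>f U\<close> plays exactly \<open>U\<close>, so the Hider's answer
      excludes \<open>x\<close> or \<open>y\<close>, and they cannot both survive in the
      outcome.\<close>
    then have "fst (p (f U)) = U"
      using p(2) U(1) f(1) unfolding follows_def \<sigma>_def by simp
    then have "snd (p (f U)) \<in> {U, topspace X - U}"
      using p(1) fU unfolding is_play_def by metis
    moreover have "x \<in> snd (p (f U))" "y \<in> snd (p (f U))"
      using xy fU by (auto simp: outcome_def)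
    ultimately show False
      using U(2) top by auto
  qed
  moreover have "is_strategy |S| X \<sigma>"
    unfolding is_strategy_def \<sigma>_def by (auto intro: op inv_into_into simp del: inv_into_f_f)
  ultimately show ?thesis
    unfolding seeker_wins_def by blast
qed

text \<open>A singleton of the sum meets each summand in a singleton or in nothing. This supplies
  the separation axiom under which \<open>sm\<close> of the sum is characterised.\<close>

lemma t1_space_sum_topology:
  assumes "\<And>i. i \<in> I \<Longrightarrow> t1_space (X i)"
  shows "t1_space (sum_topology X I)"
  unfolding t1_space_closedin_singleton
proof
  fix u assume "u \<in> topspace (sum_topology X I)"
  then obtain i x where u: "u = (i, x)" "i \<in> I" "x \<in> topspace (X i)"
    by auto
  then have "closedin (X i) {x}"
    using assms by (auto simp: t1_space_closedin_singleton)
  moreover have "{y. (j, y) \<in> {u}} = (if j = i then {x} else {})" for j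
    using u by auto
  ultimately show "closedin (sum_topology X I) {u}"
    using u by (simp add: closedin_sum_topology)
qed

text \<open>Labels from \<open>S\<close> are reused in every summand, so \<open>S\<close> has to
  bound each summand separately and not the whole sum.\<close>

lemma seeker_wins_sum_topology:
  fixes X :: "'i \<Rightarrow> 'a topology" and S :: "'b set"
  assumes t1: "\<And>i. i \<in> I \<Longrightarrow> t1_space (X i)"
    and card: "\<And>i. i \<in> I \<Longrightarrow> |topspace (X i)| \<le>o |S|"
    and Y: "Y \<subseteq> topspace (sum_topology X I)"
  shows "seeker_wins |S| Y (sum_topology X I)"
proof -
  let ?X = "sum_topology X I"
  have "\<forall>i\<in>I. \<exists>g. inj_on g (topspace (X i)) \<and> g ` topspace (X i) \<subseteq> S"
    using card by (simp add: card_of_ordLeq)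
  then obtain g where "\<forall>i\<in>I. inj_on (g i) (topspace (X i)) \<and> g i ` topspace (X i) \<subseteq> S"
    by metis
  then have inj: "\<And>i. i \<in> I \<Longrightarrow> inj_on (g i) (topspace (X i))"
    and gS: "\<And>i x. i \<in> I \<Longrightarrow> x \<in> topspace (X i) \<Longrightarrow> g i x \<in> S"
    by auto
  show ?thesis
  proof (cases "finite S")
    \<comment> \<open>For finite \<open>S\<close> two sets per label could exceed the available
      moves, so this case is separate: all summands are finite \<open>T1\<close> spaces, hence
      discrete.\<close>
    case True
    have "openin (X i) A" if "i \<in> I" "A \<subseteq> topspace (X i)" for i A
    proof -
      have "finite (topspace (X i))"
        using card[OF that(1)] True card_of_ordLeq_finite by blast
      then have "closedin (X i) (topspace (X i) - A)"
        using t1[OF that(1)] by (auto simp: t1_space_closedin_finite)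
      then show ?thesis
        using that(2) by (simp add: openin_closedin)
    qed
    moreover have "{x. (i, x) \<in> Y} \<subseteq> topspace (X i)" for i
      using Y by auto
    ultimately have op: "openin ?X Y"
      using Y by (simp add: openin_sum_topology)
    show ?thesis
    \<comment> \<open>Taking a constant image of \<open>S\<close> instead of the singleton of
      \<open>Y\<close> covers \<open>S\<close> empty: then the sum has no points and zero moves
      suffice.\<close>
    proof (rule seeker_wins_separating_family[where \<U> = "(\<lambda>_. Y) ` S"])
      fix x y assume "x \<in> topspace ?X \<inter> Y" "y \<in> topspace ?X - Y"
      then show "\<exists>U\<in>(\<lambda>_. Y) ` S. \<not> (x \<in> U \<longleftrightarrow> y \<in> U)"
        using gS by force
    qed (use op card_of_image in auto)
  next
    case False
    define A where "A \<xi> = {(i, x). i \<in> I \<and> x \<in> topspace (X i) \<and> g i x \<noteq> \<xi>}" for \<xi>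
    define B where "B \<xi> = {(i, x). i \<in> I \<and> x \<in> topspace (X i) \<and>
        (\<exists>z\<in>topspace (X i). g i z = \<xi> \<and> (i, z) \<in> Y)}" for \<xi>
    have opA: "openin ?X (A \<xi>)" for \<xi>
      unfolding openin_sum_topology
    proof (intro conjI ballI)
      fix i assume i: "i \<in> I"
      let ?F = "{x \<in> topspace (X i). g i x = \<xi>}"
      \<comment> \<open>Injectivity leaves at most one point of the summand with label \<xi>; there
        may be none.\<close>
      have "?F \<subseteq> {inv_into (topspace (X i)) (g i) \<xi>}"
        using inj[OF i] by auto
      then have "finite ?F"
        by (rule finite_subset) simp
      then have "closedin (X i) ?F"
        using t1[OF i] by (simp add: t1_space_closedin_finite)
      then have "openin (X i) (topspace (X i) - ?F)"
        by blast
      moreover have "topspace (X i) - ?F = {x. (i, x) \<in> A \<xi>}"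
        using i by (auto simp: A_def)
      ultimately show "openin (X i) {x. (i, x) \<in> A \<xi>}"
        by simp
    qed (auto simp: A_def)
    have opB: "openin ?X (B \<xi>)" for \<xi>
      unfolding openin_sum_topology
    proof (intro conjI ballI)
      fix i assume "i \<in> I"
      then have "{x. (i, x) \<in> B \<xi>} = topspace (X i) \<or> {x. (i, x) \<in> B \<xi>} = {}"
        by (auto simp: B_def)
      then show "openin (X i) {x. (i, x) \<in> B \<xi>}"
        by (elim disjE) simp_all
    qed (auto simp: B_def)
    show ?thesis
    proof (rule seeker_wins_separating_family[where \<U> = "A ` S \<union> B ` S"])
      show "|A ` S \<union> B ` S| \<le>o |S|"
        using False
        by (intro card_of_Un_ordLeq_infinite_Field card_of_image card_of_Card_order)
          (simp add: Field_card_of)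
      fix u v assume u: "u \<in> topspace ?X \<inter> Y" and v: "v \<in> topspace ?X - Y"
      obtain i x where x: "u = (i, x)" "i \<in> I" "x \<in> topspace (X i)" "(i, x) \<in> Y"
        using u by auto
      obtain j y where y: "v = (j, y)" "j \<in> I" "y \<in> topspace (X j)" "(j, y) \<notin> Y"
        using v by auto
      let ?\<xi> = "g i x"
      have \<xi>: "?\<xi> \<in> S"
        using gS x by blast
      show "\<exists>U\<in>A ` S \<union> B ` S. \<not> (u \<in> U \<longleftrightarrow> v \<in> U)"
      proof (cases "g j y = ?\<xi>")
        case True
        \<comment> \<open>By injectivity \<open>y\<close> is the only point of its summand with this
          label, and \<open>(j, y)\<close> is outside \<open>Y\<close>. The argument also covers
          \<open>i = j\<close>.\<close>
        then have "v \<notin> B ?\<xi>"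
          using y by (simp add: B_def) (metis inj inj_onD)
        moreover have "u \<in> B ?\<xi>"
          using x by (auto simp: B_def)
        ultimately show ?thesis
          using \<xi> by blast
      next
        case False
        then have "v \<in> A ?\<xi>" "u \<notin> A ?\<xi>"
          using x y by (auto simp: A_def)
        then show ?thesis
          using \<xi> by blast
      qed
    qed (use opA opB in auto)
  qed
qed

theorem theorem3p2:
  fixes \<kappa> :: "'i rel" and X :: "'i \<Rightarrow> 'a topology"
  assumes "Card_order \<kappa>"
    and "\<And>\<alpha>. \<alpha> \<in> Field \<kappa> \<Longrightarrow> t1_space (X \<alpha>)"
  shows "sm (sum_topology X (Field \<kappa>)) \<le>o ord_Sup ((\<lambda>\<alpha>. |topspace (X \<alpha>)| ) ` Field \<kappa>)"
proof -
  let ?X = "sum_topology X (Field \<kappa>)"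
  define s where "s = ord_Sup ((\<lambda>\<alpha>. |topspace (X \<alpha>)| ) ` Field \<kappa>)"
  have wo: "Well_order s"
    unfolding s_def by (rule ord_Sup_card_of_works)
  \<comment> \<open>The games above have an initial ordinal as length, while \<open>s\<close> is
    given only as a well-order. Play therefore has length \<open>|Field s|\<close>, which still
    bounds every summand and is at most \<open>s\<close>.\<close>
  have card: "|topspace (X \<alpha>)| \<le>o |Field s|" if "\<alpha> \<in> Field \<kappa>" for \<alpha>
  proof -
    have "|topspace (X \<alpha>)| \<le>o s"
      unfolding s_def using that by (rule ord_Sup_card_of_works)
    then have "|Field |topspace (X \<alpha>)| | \<le>o |Field s|"
      by (rule card_of_mono2)
    then show ?thesis
      by (simp add: Field_card_of)
  qed
  have t0: "t0_space ?X"
    using assms(2) by (simp add: t1_imp_t0_space t1_space_sum_topology)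
  have "sm ?X \<le>o |Field s|"
  proof (rule sm_works(3)[OF t0 card_of_Well_order])
    fix Y assume "Y \<subseteq> topspace ?X"
    then show "sm_set Y ?X \<le>o |Field s|"
      by (intro sm_set_works(3)[OF t0 card_of_Well_order] seeker_wins_sum_topology assms(2) card)
  qed
  also have "|Field s| \<le>o s"
    using wo by (rule card_of_least)
  finally show ?thesis
    unfolding s_def .
qed

end
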